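(* Let $(X,d)$ be a nonempty compact metric space which admits at least one chain development. Then the diameter of chain developments of $X$ is determined uniquely (i.e. $\operatorname{diam} f(X)=\operatorname{diam} g(X)$ for any two chain developments $f,g\colon X\to\mathbb{R}$) if and only if $X$ is countable.
   Context: Let $(X,d)$ be a metric space. For $\varepsilon\geqslant 0$, a finite sequence of points $x=x_0,x_1,\ldots,x_n=y$ of $X$ is an $\varepsilon$-chain from $x$ to $y$ if $d(x_i,x_{i+1})\leqslant\varepsilon$ for all $i$. The chain distance $c(x,y)$ is the infimum of all $\varepsilon$ such that there exists an $\varepsilon$-chain from $x$ to $y$ in $X$. (It may happen that $c(x,y)=0$ for $x\neq y$.) A function $f\colon X\to\mathbb{R}$ (not assumed continuous or injective) is called a chain development of $X$ if it preserves chain distance: $c(x,y)=\tilde c(f(x),f(y))$ for all $x,y\in X$, where $c$ is the chain distance on $(X,d)$ and $\tilde c$ is the chain distance on the set $f(X)\subset\mathbb{R}$ with the usual distance $|s-t|$ (chains are required to stay in $f(X)$). The diameter of a chain development $f$ is $\operatorname{diam} f(X)=\sup f(X)-\inf f(X)\in[0,\infty]$. "Countable" means finite or countably infinite. *)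

theory Defs
  imports "HOL-Analysis.Analysis"
begin

text \<open>
  A metric space is given by a set \<open>S\<close> in a type of class \<open>metric_space\<close>, with the
  restricted distance; chains have to stay in \<open>S\<close>.
\<close>

definition eps_chain :: "'a::metric_space set \<Rightarrow> real \<Rightarrow> 'a \<Rightarrow> 'a \<Rightarrow> nat \<Rightarrow> (nat \<Rightarrow> 'a) \<Rightarrow> bool"
  where "eps_chain S \<epsilon> x y n p \<longleftrightarrow>
    p 0 = x \<and> p n = y \<and> (\<forall>i\<le>n. p i \<in> S) \<and> (\<forall>i<n. dist (p i) (p (Suc i)) \<le> \<epsilon>)"

text \<open>
  For \<open>x\<close> and \<open>y\<close> in \<open>S\<close> the set below contains \<open>dist x y\<close> and is bounded below by \<open>0\<close>,
  so the infimum over the reals is the intended one. The constraint \<open>0 \<le> \<epsilon>\<close> is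
  needed because for \<open>n = 0\<close> the step condition is vacuous.
\<close>

definition chain_dist :: "'a::metric_space set \<Rightarrow> 'a \<Rightarrow> 'a \<Rightarrow> real"
  where "chain_dist S x y = Inf {\<epsilon>. 0 \<le> \<epsilon> \<and> (\<exists>n p. eps_chain S \<epsilon> x y n p)}"

text \<open>Only the values of \<open>f\<close> on \<open>X\<close> matter.\<close>

definition chain_development :: "'a::metric_space set \<Rightarrow> ('a \<Rightarrow> real) \<Rightarrow> bool"
  where "chain_development X f \<longleftrightarrow>
    (\<forall>x\<in>X. \<forall>y\<in>X. chain_dist X x y = chain_dist (f ` X) (f x) (f y))"

text \<open>
  The image of a chain development may be unbounded even if \<open>X\<close> is compact, so the
  diameter is extended-real valued (\<open>diameter\<close> is \<open>real\<close>-valued). For nonempty \<open>X\<close> the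
  supremum is not \<open>- \<infinity>\<close> and the infimum is not \<open>\<infinity>\<close>, so the difference is meaningful.
\<close>

definition development_diam :: "'a set \<Rightarrow> ('a \<Rightarrow> real) \<Rightarrow> ereal"
  where "development_diam X f = (SUP x\<in>X. ereal (f x)) - (INF x\<in>X. ereal (f x))"

end

theory Submission
  imports Defs
begin

text \<open>
  A chain development \<open>f\<close> turns chain distance into lengths of gaps: for \<open>s \<le> t\<close> in a set
  \<open>A\<close> of reals the chain distance is the length of the longest gap of \<open>A\<close> between \<open>s\<close> and
  \<open>t\<close> (\<open>chain_dist_real_le_iff\<close>). The lengths of the gaps of \<open>f ` X\<close> are dictated
  by \<open>X\<close>, so the diameter varies only through the length that the closure of \<open>f ` X\<close> itself
  occupies.

  If \<open>X\<close> is countable, there is no such length. Chain distance separates the points of a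
  countable compact space, since a chain class with two points has points at a continuum of
  distances (\<open>chain_class_intermediate_dist\<close>). Hence \<open>f ` X\<close> is compact and countable, and its
  diameter is the sum of its gaps. It remains to see that this sum does not depend on \<open>f\<close>. To
  this end consider the cost of a path through finitely many points of \<open>X\<close>, the sum of the chain
  distances of consecutive points. The path sorted by \<open>f\<close> is a cheapest one
  (\<open>path_cost_sorted_le\<close>), like a minimum spanning tree. So the cost of the path sorted by \<open>f\<close>
  is at most that of the path through the same points sorted by \<open>g\<close>, which is at most the
  diameter of \<open>g ` X\<close>; and suitable paths sorted by \<open>f\<close> cost nearly the diameter of \<open>f ` X\<close>.

  If \<open>X\<close> is uncountable, then length can be inserted. First, unbounded ends of the image are
  dense in rays and can be collapsed, so \<open>f ` X\<close> may be taken to be bounded. If the closure of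
  \<open>f ` X\<close> is uncountable, it carries a devil's staircase, a continuous monotone function that
  is constant on all gaps but not constant (\<open>devil_staircase\<close>); adding it to \<open>f\<close> keeps the
  gaps and changes the diameter. If the closure is countable, some fibre of \<open>f\<close> has more than
  one point. This fibre is a whole chain class, so it has points at all distances from one of
  them up to another, and it can be spread over an interval. In both cases the new function is a
  chain development by the same principle (\<open>chain_dist_mono_image\<close>): chain distance in a set
  of reals is preserved by continuous monotone maps that move the gaps rigidly.
\<close>

section \<open>Chain distance in a metric space\<close>

definition chain_step :: "'a::metric_space set \<Rightarrow> real \<Rightarrow> ('a \<times> 'a) set"
  where "chain_step S \<epsilon> = {(a, b). a \<in> S \<and> b \<in> S \<and> dist a b \<le> \<epsilon>}"

lemma chain_step_mono: "\<epsilon> \<le> \<delta> \<Longrightarrow> (chain_step S \<epsilon>)\<^sup>* \<subseteq> (chain_step S \<delta>)\<^sup>*"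
  by (rule rtrancl_mono) (auto simp: chain_step_def)

lemma eps_chain_iff_rtrancl:
  assumes "x \<in> S"
  shows "(\<exists>n p. eps_chain S \<epsilon> x y n p) \<longleftrightarrow> (x, y) \<in> (chain_step S \<epsilon>)\<^sup>*"
proof
  assume "\<exists>n p. eps_chain S \<epsilon> x y n p"
  then obtain n p where p: "eps_chain S \<epsilon> x y n p" by blast
  have "(x, p i) \<in> (chain_step S \<epsilon>)\<^sup>*" if "i \<le> n" for i
    using that
  proof (induction i)
    case 0
    then show ?case using p by (simp add: eps_chain_def)
  next
    case (Suc i)
    then have "(p i, p (Suc i)) \<in> chain_step S \<epsilon>"
      using p by (simp add: eps_chain_def chain_step_def)
    with Suc show ?case by (simp add: rtrancl.rtrancl_into_rtrancl)
  qed
  from this[of n] show "(x, y) \<in> (chain_step S \<epsilon>)\<^sup>*"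
    using p by (simp add: eps_chain_def)
next
  assume "(x, y) \<in> (chain_step S \<epsilon>)\<^sup>*"
  then show "\<exists>n p. eps_chain S \<epsilon> x y n p"
  proof (induction rule: rtrancl_induct)
    case base
    have "eps_chain S \<epsilon> x x 0 (\<lambda>_. x)" using assms by (simp add: eps_chain_def)
    then show ?case by blast
  next
    case (step y z)
    then obtain n p where "eps_chain S \<epsilon> x y n p" by blast
    then have "eps_chain S \<epsilon> x z (Suc n) (p(Suc n := z))"
      using step.hyps by (auto simp: eps_chain_def chain_step_def less_Suc_eq le_Suc_eq)
    then show ?case by blast
  qed
qed

lemma chain_dist_le:
  assumes "x \<in> S" "0 \<le> \<epsilon>" "(x, y) \<in> (chain_step S \<epsilon>)\<^sup>*"
  shows "chain_dist S x y \<le> \<epsilon>"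
  unfolding chain_dist_def
proof (rule cInf_lower)
  show "\<epsilon> \<in> {\<epsilon>. 0 \<le> \<epsilon> \<and> (\<exists>n p. eps_chain S \<epsilon> x y n p)}"
    using assms by (simp add: eps_chain_iff_rtrancl)
qed (auto intro: bdd_belowI[of _ 0])

lemma dist_chain_step: "x \<in> S \<Longrightarrow> y \<in> S \<Longrightarrow> (x, y) \<in> (chain_step S (dist x y))\<^sup>*"
  by (rule r_into_rtrancl) (simp add: chain_step_def)

lemma chain_dist_le_dist: "x \<in> S \<Longrightarrow> y \<in> S \<Longrightarrow> chain_dist S x y \<le> dist x y"
  by (rule chain_dist_le) (simp_all add: dist_chain_step)

lemma
  assumes "x \<in> S" "y \<in> S"
  shows chain_dist_nonneg: "0 \<le> chain_dist S x y"
    and chain_of_chain_dist_less: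
      "\<And>\<epsilon>. chain_dist S x y < \<epsilon> \<Longrightarrow> (x, y) \<in> (chain_step S \<epsilon>)\<^sup>*"
proof -
  let ?E = "{\<epsilon>. 0 \<le> \<epsilon> \<and> (\<exists>n p. eps_chain S \<epsilon> x y n p)}"
  have ne: "?E \<noteq> {}"
    using dist_chain_step[OF assms] eps_chain_iff_rtrancl[OF assms(1), of "dist x y" y]
    by (auto intro!: exI[of _ "dist x y"])
  show "0 \<le> chain_dist S x y"
    unfolding chain_dist_def using ne by (rule cInf_greatest) simp
  show "(x, y) \<in> (chain_step S \<epsilon>)\<^sup>*" if less: "chain_dist S x y < \<epsilon>" for \<epsilon>
  proof -
    obtain \<delta> where \<delta>: "\<delta> \<in> ?E" "\<delta> < \<epsilon>"
      using cInf_lessD[OF ne less[unfolded chain_dist_def]] by blast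
    then have "(x, y) \<in> (chain_step S \<delta>)\<^sup>*"
      using eps_chain_iff_rtrancl[OF assms(1), of \<delta> y] by simp
    then show ?thesis
      using chain_step_mono[of \<delta> \<epsilon> S] \<delta>(2) by (meson less_imp_le subsetD)
  qed
qed

lemma chain_dist_self: "x \<in> S \<Longrightarrow> chain_dist S x x = 0"
  using chain_dist_le_dist[of x S x] chain_dist_nonneg[of x S x] by simp

lemma chain_dist_commute:
  assumes "x \<in> S" "y \<in> S"
  shows "chain_dist S x y = chain_dist S y x"
proof -
  have "(chain_step S \<epsilon>)\<inverse> = chain_step S \<epsilon>" for \<epsilon>
    by (auto simp: chain_step_def dist_commute)
  then have "(x, y) \<in> (chain_step S \<epsilon>)\<^sup>* \<longleftrightarrow> (y, x) \<in> (chain_step S \<epsilon>)\<^sup>*" for \<epsilon>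
    by (metis rtrancl_converseD rtrancl_converseI)
  then show ?thesis
    using assms by (simp add: chain_dist_def eps_chain_iff_rtrancl)
qed

lemma chain_dist_ultrametric:
  assumes "x \<in> S" "y \<in> S" "z \<in> S"
  shows "chain_dist S x z \<le> max (chain_dist S x y) (chain_dist S y z)"
proof (rule dense_ge)
  fix \<epsilon> assume e: "max (chain_dist S x y) (chain_dist S y z) < \<epsilon>"
  then have "(x, z) \<in> (chain_step S \<epsilon>)\<^sup>*"
    using chain_of_chain_dist_less[of x S y \<epsilon>] chain_of_chain_dist_less[of y S z \<epsilon>] assms
    by (simp add: rtrancl_trans)
  moreover have "0 \<le> \<epsilon>" using e chain_dist_nonneg[OF assms(1,2)] by simp
  ultimately show "chain_dist S x z \<le> \<epsilon>" using assms(1) by (simp add: chain_dist_le)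
qed

text \<open>
  A chain from \<open>x\<close> to \<open>y\<close> cannot skip a distance \<open>r\<close> from \<open>x\<close> by more than its step length.
  Compactness turns the points found in this way for ever smaller steps into a point of the chain
  class of \<open>x\<close> at distance exactly \<open>r\<close>. So a chain class behaves like a connected set.
\<close>

lemma chain_class_intermediate_dist:
  fixes S :: "'a::metric_space set"
  assumes "compact S" "x \<in> S" "y \<in> S" "chain_dist S x y = 0" "0 \<le> r" "r \<le> dist x y"
  obtains z where "z \<in> S" "chain_dist S x z = 0" "dist x z = r"
proof -
  have ex: "\<exists>z. z \<in> S \<and> (x, z) \<in> (chain_step S \<epsilon>)\<^sup>* \<and> r \<le> dist x z \<and> dist x z \<le> r + \<epsilon>"
    if "0 < \<epsilon>" for \<epsilon>
  proof -
    have "(x, y) \<in> (chain_step S \<epsilon>)\<^sup>*"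
      using assms that by (intro chain_of_chain_dist_less) auto
    then have "r \<le> dist x y \<longrightarrow> ?thesis"
    proof (induction rule: rtrancl_induct)
      case base
      then show ?case using assms that by (auto intro!: exI[of _ x])
    next
      case (step w z)
      have "dist x z \<le> dist x w + dist w z" by (rule dist_triangle)
      with step show ?case
        by (cases "r \<le> dist x w")
          (auto simp: chain_step_def intro!: exI[of _ z] intro: rtrancl.rtrancl_into_rtrancl)
    qed
    then show ?thesis using assms by simp
  qed
  define \<epsilon> where "\<epsilon> = (\<lambda>n. inverse (real (Suc n)))"
  have \<epsilon>: "0 < \<epsilon> n" for n by (simp add: \<epsilon>_def)
  have "\<epsilon> \<longlonglongrightarrow> 0" unfolding \<epsilon>_def by (rule LIMSEQ_inverse_real_of_nat)
  obtain z where z: "z n \<in> S" "(x, z n) \<in> (chain_step S (\<epsilon> n))\<^sup>*"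
      "r \<le> dist x (z n)" "dist x (z n) \<le> r + \<epsilon> n" for n
    using ex[OF \<epsilon>] by metis
  obtain l \<sigma> where l: "l \<in> S" "strict_mono \<sigma>" "(z \<circ> \<sigma>) \<longlonglongrightarrow> l"
    using assms(1) z(1) unfolding compact_def by metis
  have lim\<epsilon>: "(\<lambda>n. \<epsilon> (\<sigma> n)) \<longlonglongrightarrow> 0"
    using LIMSEQ_subseq_LIMSEQ[OF \<open>\<epsilon> \<longlonglongrightarrow> 0\<close> l(2)] by (simp add: o_def)
  have lim: "(\<lambda>n. z (\<sigma> n)) \<longlonglongrightarrow> l" using l(3) by (simp add: o_def)
  have d: "(\<lambda>n. dist x (z (\<sigma> n))) \<longlonglongrightarrow> dist x l"
    by (intro tendsto_intros lim)
  have "dist x l \<le> r"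
    using LIMSEQ_le[OF d tendsto_add[OF tendsto_const[of r] lim\<epsilon>]] z(4) by auto
  moreover have "r \<le> dist x l"
    using LIMSEQ_le_const[OF d, of r] z(3) by auto
  moreover have "chain_dist S x l \<le> 0"
  proof (rule LIMSEQ_le_const)
    show "(\<lambda>n. max (\<epsilon> (\<sigma> n)) (dist (z (\<sigma> n)) l)) \<longlonglongrightarrow> 0"
      using tendsto_max[OF lim\<epsilon> tendsto_dist[OF lim tendsto_const[of l]]] by simp
    have "chain_dist S x l \<le> max (\<epsilon> (\<sigma> n)) (dist (z (\<sigma> n)) l)" for n
    proof -
      have "chain_dist S x (z (\<sigma> n)) \<le> \<epsilon> (\<sigma> n)"
        using \<epsilon>[of "\<sigma> n"] z assms(2) by (intro chain_dist_le) auto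
      moreover have "chain_dist S (z (\<sigma> n)) l \<le> dist (z (\<sigma> n)) l"
        using z l by (intro chain_dist_le_dist) auto
      ultimately show ?thesis
        using chain_dist_ultrametric[of x S "z (\<sigma> n)" l] z(1) l(1) assms(2) by fastforce
    qed
    then show "\<exists>N. \<forall>n\<ge>N. chain_dist S x l \<le> max (\<epsilon> (\<sigma> n)) (dist (z (\<sigma> n)) l)" by blast
  qed
  ultimately show ?thesis
    using that[of l] l(1) chain_dist_nonneg[OF assms(2) l(1)] by simp
qed

lemma chain_dist_eq_0_imp_eq_of_countable:
  assumes "compact S" "countable S" "x \<in> S" "y \<in> S" "chain_dist S x y = 0"
  shows "x = y"
proof (rule ccontr)
  assume "x \<noteq> y"
  have "{0..dist x y} \<subseteq> dist x ` S"
  proof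
    fix r assume "r \<in> {0..dist x y}"
    then have "0 \<le> r" "r \<le> dist x y" by auto
    from chain_class_intermediate_dist[OF assms(1,3-5) this]
    obtain z where "z \<in> S" "dist x z = r" by blast
    then show "r \<in> dist x ` S" by auto
  qed
  then have "countable {0..dist x y}"
    using assms(2) countable_subset by blast
  then show False using \<open>x \<noteq> y\<close> uncountable_closed_interval[of 0 "dist x y"] by simp
qed

section \<open>Chain distance in a set of reals\<close>

text \<open>
  On the line the chain distance of two points is the length of the longest gap between them.
  Gaps are described by the open intervals that miss \<open>A\<close>, since the endpoints of a gap need not
  belong to \<open>A\<close>.
\<close>

lemma chain_dist_real_le_iff:
  fixes A :: "real set"
  assumes "s \<in> A" "t \<in> A" "s \<le> t" "0 \<le> \<epsilon>"
  shows "chain_dist A s t \<le> \<epsilon> \<longleftrightarrow>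
    (\<forall>u v. s \<le> u \<longrightarrow> v \<le> t \<longrightarrow> \<epsilon> < v - u \<longrightarrow> A \<inter> {u<..<v} \<noteq> {})"
proof (intro iffI allI impI notI)
  fix u v assume le: "chain_dist A s t \<le> \<epsilon>" and uv: "s \<le> u" "v \<le> t" "\<epsilon> < v - u"
    and empty: "A \<inter> {u<..<v} = {}"
  obtain \<delta> where \<delta>: "\<epsilon> < \<delta>" "\<delta> < v - u" using dense[OF uv(3)] by blast
  have "(s, t) \<in> (chain_step A \<delta>)\<^sup>*"
    using assms le \<delta> by (intro chain_of_chain_dist_less) auto
  then have "t \<le> u"
  proof (induction rule: rtrancl_induct)
    case (step y z)
    then have "z < v" "z \<in> A" using \<delta> by (auto simp: chain_step_def dist_real_def)
    then show ?case using empty by force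
  qed (use uv in simp)
  then show False using uv assms by linarith
next
  assume gap: "\<forall>u v. s \<le> u \<longrightarrow> v \<le> t \<longrightarrow> \<epsilon> < v - u \<longrightarrow> A \<inter> {u<..<v} \<noteq> {}"
  show "chain_dist A s t \<le> \<epsilon>"
  proof (rule dense_ge)
    fix \<delta> assume "\<epsilon> < \<delta>"
    then obtain \<eta> where \<eta>: "0 < \<eta>" "\<eta> < \<delta> - \<epsilon>"
      using dense[of 0 "\<delta> - \<epsilon>"] by auto
    \<comment> \<open>Unless \<open>t\<close> is within reach, a step of length at most \<open>\<delta>\<close> can gain at least \<open>\<eta>\<close>.\<close>
    have "(p, t) \<in> (chain_step A \<delta>)\<^sup>*" if "p \<in> A" "s \<le> p" "p \<le> t" "t - p \<le> real n * \<eta>" for n p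
      using that
    proof (induction n arbitrary: p)
      case 0
      then show ?case by simp
    next
      case (Suc n)
      show ?case
      proof (cases "t - p \<le> \<delta>")
        case True
        then show ?thesis using Suc.prems assms
          by (intro r_into_rtrancl) (auto simp: chain_step_def dist_real_def)
      next
        case False
        with gap[rule_format, of "p + \<eta>" "p + \<delta>"] Suc.prems \<eta>
        obtain q where q: "q \<in> A" "p + \<eta> < q" "q < p + \<delta>" by auto
        have "(p, q) \<in> chain_step A \<delta>"
          using q Suc.prems \<eta> by (auto simp: chain_step_def dist_real_def)
        moreover have "(q, t) \<in> (chain_step A \<delta>)\<^sup>*"
          using q Suc.prems \<eta> False by (intro Suc.IH) (auto simp: algebra_simps)
        ultimately show ?thesis by (rule converse_rtrancl_into_rtrancl)
      qed
    qed
    moreover obtain n where "t - s \<le> real n * \<eta>"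
      using reals_Archimedean3[OF \<eta>(1)] less_le by blast
    ultimately show "chain_dist A s t \<le> \<delta>"
      using assms \<open>\<epsilon> < \<delta>\<close> by (intro chain_dist_le) auto
  qed
qed

lemma chain_dist_real_mono:
  fixes A :: "real set"
  assumes "s \<in> A" "t \<in> A" "u \<in> A" "s \<le> t" "t \<le> u"
  shows "chain_dist A s t \<le> chain_dist A s u"
proof -
  have nn: "0 \<le> chain_dist A s u" using assms chain_dist_nonneg by blast
  show ?thesis
    using chain_dist_real_le_iff[of s A u "chain_dist A s u"] assms nn
    by (subst chain_dist_real_le_iff) auto
qed

lemma chain_dist_gap:
  fixes A :: "real set"
  assumes "s \<in> A" "t \<in> A" "s \<le> t" "A \<inter> {s<..<t} = {}"
  shows "t - s \<le> chain_dist A s t"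
  using chain_dist_real_le_iff[of s A t "chain_dist A s t"] assms chain_dist_nonneg[of s A t]
  by force

lemma chain_dist_eq_0_between_if_dense:
  fixes A :: "real set"
  assumes "l < r" and dense: "\<And>u v. l \<le> u \<Longrightarrow> u < v \<Longrightarrow> v \<le> r \<Longrightarrow> A \<inter> {u<..<v} \<noteq> {}"
  obtains p q where "p \<in> A" "q \<in> A" "p < q" "chain_dist A p q = 0"
proof -
  define m where "m = (l + r) / 2"
  have m: "l < m" "m < r" using assms(1) by (auto simp: m_def)
  obtain p where p: "p \<in> A" "l < p" "p < m" using dense[of l m] m by auto
  obtain q where q: "q \<in> A" "m < q" "q < r" using dense[of m r] m by auto
  have "chain_dist A p q \<le> 0"
    using p q dense by (subst chain_dist_real_le_iff) auto
  then show ?thesis using that[of p q] p q chain_dist_nonneg[of p A q] by auto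
qed

lemma dense_if_chain_dist_eq_0:
  fixes A :: "real set"
  assumes "p \<in> A" "q \<in> A" "p < q" "chain_dist A p q = 0"
  shows "{p..q} \<subseteq> closure A"
proof
  fix t assume t: "t \<in> {p..q}"
  show "t \<in> closure A"
    unfolding closure_approachable
  proof (intro allI impI)
    fix e :: real assume "0 < e"
    have "max p (t - e) < min q (t + e)" using t assms \<open>0 < e\<close> by auto
    then have "A \<inter> {max p (t - e)<..<min q (t + e)} \<noteq> {}"
      using chain_dist_real_le_iff[of p A q 0] assms by auto
    then obtain a where "a \<in> A" "t - e < a" "a < t + e" by auto
    then show "\<exists>y\<in>A. dist y t < e" by (auto simp: dist_real_def intro!: bexI[of _ a])
  qed
qed

text \<open>
  A map that moves the gaps of \<open>A\<close> rigidly keeps their lengths, and a continuous one opens no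
  new gaps. Monotonicity is meant in the weak sense, so that maps that collapse a dense part of
  \<open>A\<close> to a point are included.
\<close>

lemma chain_dist_mono_image:
  fixes A :: "real set" and \<phi> :: "real \<Rightarrow> real"
  assumes "mono \<phi>" "continuous_on UNIV \<phi>"
    and rigid: "\<And>u v a b. a \<in> A \<Longrightarrow> b \<in> A \<Longrightarrow> a \<le> u \<Longrightarrow> u < v \<Longrightarrow> v \<le> b \<Longrightarrow>
      A \<inter> {u<..<v} = {} \<Longrightarrow> \<phi> v - \<phi> u = v - u"
    and "s \<in> A" "t \<in> A"
  shows "chain_dist (\<phi> ` A) (\<phi> s) (\<phi> t) = chain_dist A s t"
proof -
  have le: "chain_dist (\<phi> ` A) (\<phi> s) (\<phi> t) = chain_dist A s t"
    if st: "s \<in> A" "t \<in> A" "s \<le> t" for s t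
  proof -
    have \<phi>st: "\<phi> s \<le> \<phi> t" using assms(1) st by (simp add: monoD)
    have "chain_dist (\<phi> ` A) (\<phi> s) (\<phi> t) \<le> \<epsilon> \<longleftrightarrow> chain_dist A s t \<le> \<epsilon>" if "0 \<le> \<epsilon>" for \<epsilon>
    proof -
      have "(\<forall>u v. \<phi> s \<le> u \<longrightarrow> v \<le> \<phi> t \<longrightarrow> \<epsilon> < v - u \<longrightarrow> \<phi> ` A \<inter> {u<..<v} \<noteq> {}) \<longleftrightarrow>
        (\<forall>u v. s \<le> u \<longrightarrow> v \<le> t \<longrightarrow> \<epsilon> < v - u \<longrightarrow> A \<inter> {u<..<v} \<noteq> {})"
      proof (intro iffI allI impI)
        fix u v assume hit: "\<forall>u v. s \<le> u \<longrightarrow> v \<le> t \<longrightarrow> \<epsilon> < v - u \<longrightarrow> A \<inter> {u<..<v} \<noteq> {}"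
          and uv: "\<phi> s \<le> u" "v \<le> \<phi> t" "\<epsilon> < v - u"
        \<comment> \<open>Shrinking \<open>(u, v)\<close> a little keeps the preimages of its endpoints away from
          points of \<open>A\<close> that are mapped to \<open>u\<close> or \<open>v\<close>.\<close>
        define \<eta> where "\<eta> = (v - u - \<epsilon>) / 3"
        have \<eta>: "0 < \<eta>" "\<epsilon> < (v - \<eta>) - (u + \<eta>)" using uv(3) by (auto simp: \<eta>_def field_simps)
        have c: "continuous_on {s..t} \<phi>" using assms(2) continuous_on_subset by blast
        have ivt: "\<exists>x\<ge>s. x \<le> t \<and> \<phi> x = y" if "\<phi> s \<le> y" "y \<le> \<phi> t" for y
          using IVT'[of \<phi> s y t] that st c by blast
        obtain x where x: "s \<le> x" "x \<le> t" "\<phi> x = u + \<eta>"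
          using ivt[of "u + \<eta>"] uv \<eta> \<open>0 \<le> \<epsilon>\<close> by auto
        obtain y where y: "s \<le> y" "y \<le> t" "\<phi> y = v - \<eta>"
          using ivt[of "v - \<eta>"] uv \<eta> \<open>0 \<le> \<epsilon>\<close> by auto
        have "x < y"
          using x y \<eta> \<open>0 \<le> \<epsilon>\<close> monoD[OF assms(1), of y x] by (cases "x < y") auto
        have "A \<inter> {x<..<y} \<noteq> {}"
        proof
          assume e: "A \<inter> {x<..<y} = {}"
          then have "y - x = (v - \<eta>) - (u + \<eta>)"
            using rigid[OF st(1,2) x(1) \<open>x < y\<close> y(2) e] x y by simp
          then show False using hit x y e \<eta> by auto
        qed
        then obtain a where "a \<in> A" "x < a" "a < y" by auto
        then have "\<phi> a \<in> \<phi> ` A \<inter> {u<..<v}"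
          using monoD[OF assms(1), of x a] monoD[OF assms(1), of a y] x y \<eta> by auto
        then show "\<phi> ` A \<inter> {u<..<v} \<noteq> {}" by blast
      next
        fix u v assume hit: "\<forall>u v. \<phi> s \<le> u \<longrightarrow> v \<le> \<phi> t \<longrightarrow> \<epsilon> < v - u \<longrightarrow> \<phi> ` A \<inter> {u<..<v} \<noteq> {}"
          and uv: "s \<le> u" "v \<le> t" "\<epsilon> < v - u"
        show "A \<inter> {u<..<v} \<noteq> {}"
        proof
          assume e: "A \<inter> {u<..<v} = {}"
          then have "\<phi> v - \<phi> u = v - u"
            using rigid[OF st(1,2) uv(1) _ uv(2) e] uv \<open>0 \<le> \<epsilon>\<close> by auto
          then have "\<phi> ` A \<inter> {\<phi> u<..<\<phi> v} \<noteq> {}"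
            using hit uv monoD[OF assms(1)] by auto
          then obtain a where a: "a \<in> A" "\<phi> u < \<phi> a" "\<phi> a < \<phi> v" by auto
          then have "u < a" "a < v"
            using monoD[OF assms(1), of a u] monoD[OF assms(1), of v a] by force+
          then show False using a e by auto
        qed
      qed
      then show ?thesis
        using chain_dist_real_le_iff[of "\<phi> s" "\<phi> ` A" "\<phi> t" \<epsilon>]
          chain_dist_real_le_iff[of s A t \<epsilon>] st \<phi>st that by simp
    qed
    from this[of "chain_dist A s t"] this[of "chain_dist (\<phi> ` A) (\<phi> s) (\<phi> t)"]
    show ?thesis
      using chain_dist_nonneg[of s A t] chain_dist_nonneg[of "\<phi> s" "\<phi> ` A" "\<phi> t"] st by auto
  qed
  show ?thesis
  proof (cases "s \<le> t")
    case True
    then show ?thesis using le assms by blast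
  next
    case False
    then show ?thesis
      using le[of t s] assms chain_dist_commute[of s A t]
        chain_dist_commute[of "\<phi> s" "\<phi> ` A" "\<phi> t"] by simp
  qed
qed

lemma chain_dist_uminus_image:
  fixes A :: "real set"
  shows "chain_dist (uminus ` A) (- s) (- t) = chain_dist A s t"
proof -
  have *: "eps_chain (uminus ` A) \<epsilon> (- s) (- t) n (\<lambda>i. - p i)"
    if "eps_chain A \<epsilon> s t n p" for A :: "real set" and \<epsilon> s t n p
    using that by (simp add: eps_chain_def dist_minus)
  have "(\<exists>n p. eps_chain (uminus ` A) \<epsilon> (- s) (- t) n p) \<longleftrightarrow> (\<exists>n p. eps_chain A \<epsilon> s t n p)" for \<epsilon>
  proof
    assume "\<exists>n p. eps_chain (uminus ` A) \<epsilon> (- s) (- t) n p"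
    then obtain n p where "eps_chain (uminus ` A) \<epsilon> (- s) (- t) n p" by blast
    from *[OF this] show "\<exists>n p. eps_chain A \<epsilon> s t n p" by (auto simp: image_image)
  qed (use * in blast)
  then show ?thesis by (simp add: chain_dist_def)
qed

section \<open>Modifying chain developments\<close>

text \<open>
  Read from right to left, this modifies a given development; read from left to right, it shows
  that \<open>f\<close> is a development if collapsing parts of its image leads to one.
\<close>

lemma chain_development_mono_comp_iff:
  fixes \<phi> :: "real \<Rightarrow> real"
  assumes "mono \<phi>" "continuous_on UNIV \<phi>"
    and "\<And>u v a b. a \<in> f ` X \<Longrightarrow> b \<in> f ` X \<Longrightarrow> a \<le> u \<Longrightarrow> u < v \<Longrightarrow> v \<le> b \<Longrightarrow>
      f ` X \<inter> {u<..<v} = {} \<Longrightarrow> \<phi> v - \<phi> u = v - u"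
  shows "chain_development X (\<phi> \<circ> f) \<longleftrightarrow> chain_development X f"
proof -
  have "chain_dist (\<phi> ` f ` X) (\<phi> (f x)) (\<phi> (f y)) = chain_dist (f ` X) (f x) (f y)"
    if "x \<in> X" "y \<in> X" for x y
    by (rule chain_dist_mono_image[OF assms]) (use that in auto)
  then show ?thesis by (simp add: chain_development_def image_comp)
qed

lemma chain_development_uminus:
  "chain_development X f \<Longrightarrow> chain_development X (\<lambda>x. - f x)"
  using chain_dist_uminus_image[of "f ` X"] by (simp add: chain_development_def image_image)

text \<open>
  Chain distance is at most the distance in \<open>X\<close>, so the image inherits sequential compactness
  with respect to chain distance.
\<close>

lemma chain_development_subseq:
  fixes a :: "nat \<Rightarrow> real"
  assumes "compact X" "chain_development X f" "\<And>n. a n \<in> f ` X"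
  obtains l \<sigma> where "l \<in> f ` X" "strict_mono \<sigma>" "(\<lambda>n. chain_dist (f ` X) l (a (\<sigma> n))) \<longlonglongrightarrow> 0"
proof -
  have "\<exists>x. x \<in> X \<and> f x = a n" for n using assms(3)[of n] by auto
  then obtain x where x: "x n \<in> X" "f (x n) = a n" for n by metis
  obtain z \<sigma> where z: "z \<in> X" "strict_mono \<sigma>" "(x \<circ> \<sigma>) \<longlonglongrightarrow> z"
    using assms(1)[unfolded compact_def, rule_format, of x] x(1) by blast
  have "(\<lambda>n. dist z (x (\<sigma> n))) \<longlonglongrightarrow> 0"
    using tendsto_dist[OF tendsto_const[of z] z(3)] by (simp add: o_def)
  moreover have "chain_dist (f ` X) (f z) (a (\<sigma> n)) = chain_dist X z (x (\<sigma> n))" for n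
    using assms(2) x z(1) by (simp add: chain_development_def flip: x(2))
  ultimately have "(\<lambda>n. chain_dist (f ` X) (f z) (a (\<sigma> n))) \<longlonglongrightarrow> 0"
    using chain_dist_le_dist[OF z(1) x(1)] chain_dist_nonneg[OF z(1) x(1)]
    by (auto intro: Lim_null_comparison[rotated])
  with z that show ?thesis by blast
qed

text \<open>
  If the image is unbounded above, then it is dense in some ray \<open>[a, \<infinity>)\<close>: a sequence tending to
  \<open>\<infinity>\<close> subconverges in chain distance to some \<open>a\<close>, and so no gap can lie beyond \<open>a\<close>.
  Collapsing this ray to its left endpoint makes the development bounded above.
\<close>

lemma bounded_above_chain_development:
  assumes "compact X" "chain_development X f"
  shows "\<exists>g. chain_development X g \<and> bdd_above (g ` X) \<and>
    (bdd_below (f ` X) \<longrightarrow> bdd_below (g ` X))"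
proof (cases "bdd_above (f ` X)")
  case True
  then show ?thesis using assms by blast
next
  case False
  let ?A = "f ` X"
  have "\<exists>y\<in>?A. real n < y" for n :: nat
    using False by (meson bdd_above.I linorder_not_less)
  then obtain b where b: "b n \<in> ?A" "real n < b n" for n by metis
  obtain a \<sigma> where a: "a \<in> ?A" "strict_mono \<sigma>" "(\<lambda>n. chain_dist ?A a (b (\<sigma> n))) \<longlonglongrightarrow> 0"
    using chain_development_subseq[where a = b, OF assms b(1)] by blast
  have hit: "?A \<inter> {u<..<v} \<noteq> {}" if "a \<le> u" "u < v" for u v
  proof -
    have "\<forall>\<^sub>F n in sequentially. chain_dist ?A a (b (\<sigma> n)) < v - u"
      using order_tendstoD(2)[OF a(3), of "v - u"] that by simp
    moreover have "\<forall>\<^sub>F n in sequentially. v < real n"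
      by (rule eventually_compose_filterlim[OF eventually_gt_at_top filterlim_real_sequentially])
    ultimately have "\<forall>\<^sub>F n in sequentially. chain_dist ?A a (b (\<sigma> n)) < v - u \<and> v < real n"
      by (rule eventually_conj)
    then obtain n where n: "chain_dist ?A a (b (\<sigma> n)) < v - u" "v < real n"
      by (auto dest: eventually_happens)
    have "v < b (\<sigma> n)"
      using n(2) b(2)[of "\<sigma> n"] seq_suble[OF a(2), of n] by linarith
    then show ?thesis
      using chain_dist_real_le_iff[of a ?A "b (\<sigma> n)" "chain_dist ?A a (b (\<sigma> n))"] n that a(1) b(1)
        chain_dist_nonneg[OF a(1) b(1), of "\<sigma> n"] by auto
  qed
  let ?\<phi> = "\<lambda>t. min t a"
  have "chain_development X (?\<phi> \<circ> f)"
  proof (subst chain_development_mono_comp_iff)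
    show "min v a - min u a = v - u" if "u < v" "?A \<inter> {u<..<v} = {}" for u v
    proof -
      have "v \<le> a"
        using hit[of "max u a" v] that by (fastforce simp: max_def split: if_splits)
      with that show ?thesis by simp
    qed
  qed (use assms(2) in \<open>auto intro!: continuous_intros monoI\<close>)
  moreover have "bdd_above ((?\<phi> \<circ> f) ` X)" by (auto intro!: bdd_aboveI[of _ a])
  moreover have "bdd_below ((?\<phi> \<circ> f) ` X)" if below: "bdd_below ?A"
  proof -
    obtain m where "\<And>x. x \<in> X \<Longrightarrow> m \<le> f x" using below by (auto simp: bdd_below_def)
    then show ?thesis by (auto intro!: bdd_belowI[of _ "min m a"] simp: min_le_iff_disj)
  qed
  ultimately show ?thesis by (intro exI[of _ "?\<phi> \<circ> f"]) simp
qed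

lemma bounded_chain_development:
  assumes "compact X" "chain_development X f"
  shows "\<exists>g. chain_development X g \<and> bdd_above (g ` X) \<and> bdd_below (g ` X)"
proof -
  obtain f1 where f1: "chain_development X f1" "bdd_above (f1 ` X)"
    using bounded_above_chain_development[OF assms] by auto
  obtain f2 where f2: "chain_development X f2" "bdd_above (f2 ` X)"
      "bdd_below ((\<lambda>x. - f1 x) ` X) \<longrightarrow> bdd_below (f2 ` X)"
    using bounded_above_chain_development[OF assms(1) chain_development_uminus[OF f1(1)]] by auto
  have "bdd_below ((\<lambda>x. - f1 x) ` X)"
    using f1(2) bdd_below_image_antimono[of uminus "f1 ` X"]
    by (simp add: image_image antimono_def)
  with f2 show ?thesis by (intro exI[of _ f2]) simp
qed

lemma development_diam_bounded:
  assumes "X \<noteq> {}" "bdd_above (f ` X)" "bdd_below (f ` X)"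
  shows "development_diam X f = ereal (Sup (f ` X) - Inf (f ` X))"
proof -
  have "(SUP x\<in>X. ereal (f x)) = ereal (Sup (f ` X))"
  proof (rule antisym)
    show "ereal (Sup (f ` X)) \<le> (SUP x\<in>X. ereal (f x))"
    proof (cases "SUP x\<in>X. ereal (f x)")
      case (real r)
      then have "f x \<le> r" if "x \<in> X" for x
        using SUP_upper[of x X "\<lambda>x. ereal (f x)"] that by simp
      then show ?thesis using assms(1) real by (auto intro: cSUP_least)
    next
      case MInf
      then show ?thesis using assms(1) SUP_upper[of _ X "\<lambda>x. ereal (f x)"] by fastforce
    qed simp
  qed (use assms(2) in \<open>auto intro!: SUP_least cSup_upper\<close>)
  moreover have "(INF x\<in>X. ereal (f x)) = ereal (Inf (f ` X))"
  proof (rule antisym)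
    show "(INF x\<in>X. ereal (f x)) \<le> ereal (Inf (f ` X))"
    proof (cases "INF x\<in>X. ereal (f x)")
      case (real r)
      then have "r \<le> f x" if "x \<in> X" for x
        using INF_lower[of x X "\<lambda>x. ereal (f x)"] that by simp
      then show ?thesis using assms(1) real by (auto intro: cINF_greatest)
    next
      case PInf
      then show ?thesis using assms(1) INF_lower[of _ X "\<lambda>x. ereal (f x)"] by fastforce
    qed simp
  qed (use assms(3) in \<open>auto intro!: INF_greatest cInf_lower\<close>)
  ultimately show ?thesis by (simp add: development_diam_def)
qed

lemma development_diam_mono_comp:
  fixes \<phi> :: "real \<Rightarrow> real"
  assumes "X \<noteq> {}" "bdd_above (f ` X)" "bdd_below (f ` X)" "mono \<phi>" "continuous_on UNIV \<phi>"
  shows "development_diam X (\<phi> \<circ> f) = ereal (\<phi> (Sup (f ` X)) - \<phi> (Inf (f ` X)))"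
proof -
  have c: "continuous (at t within T) \<phi>" for t T
    using assms(5) by (simp add: continuous_on_eq_continuous_at continuous_at_imp_continuous_at_within)
  have "\<phi> (Sup (f ` X)) = Sup ((\<phi> \<circ> f) ` X)"
    using continuous_at_Sup_mono[OF assms(4) c, of "f ` X"] assms by (simp add: image_comp)
  moreover have "\<phi> (Inf (f ` X)) = Inf ((\<phi> \<circ> f) ` X)"
    using continuous_at_Inf_mono[OF assms(4) c, of "f ` X"] assms by (simp add: image_comp)
  moreover have "bdd_above ((\<phi> \<circ> f) ` X)"
    using bdd_above_image_mono[OF assms(4,2)] by (simp add: image_comp)
  moreover have "bdd_below ((\<phi> \<circ> f) ` X)"
    using bdd_below_image_mono[OF assms(4,3)] by (simp add: image_comp)
  ultimately show ?thesis using development_diam_bounded[OF assms(1), of "\<phi> \<circ> f"] by simp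
qed

section \<open>A devil's staircase on an uncountable set\<close>

text \<open>
  Let \<open>\<alpha>\<close> be the supremum of the points up to which \<open>K\<close> is countable. What lies beyond \<open>\<alpha>\<close>
  is uncountable, so it still is if a sufficiently short piece next to \<open>\<alpha>\<close> is removed; and
  the part of \<open>K\<close> up to the end of that piece is uncountable by the choice of \<open>\<alpha>\<close>.
\<close>

lemma uncountable_Int_split:
  fixes K :: "real set"
  assumes "uncountable (K \<inter> {s..t})"
  shows "\<exists>m. s < m \<and> m < t \<and> uncountable (K \<inter> {s..m}) \<and> uncountable (K \<inter> {m..t})"
proof -
  let ?\<delta> = "\<lambda>n. inverse (real (Suc n))"
  have small: "\<exists>n. ?\<delta> n < x" if "0 < x" for x :: real
    using reals_Archimedean[OF that] .
  define E where "E = {u \<in> {s..t}. countable (K \<inter> {s..u})}"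
  define \<alpha> where "\<alpha> = Sup E"
  have "s \<le> t" using assms by (cases "s \<le> t") auto
  then have "s \<in> E" by (simp add: E_def countable_finite)
  have bdd: "bdd_above E" by (auto simp: E_def intro: bdd_aboveI[of _ t])
  have "s \<le> \<alpha>" using \<open>s \<in> E\<close> bdd by (simp add: \<alpha>_def cSup_upper)
  have left: "countable (K \<inter> {s..\<alpha> - ?\<delta> n})" for n
  proof -
    have "\<alpha> - ?\<delta> n < Sup E" by (simp add: \<alpha>_def)
    then obtain u where "u \<in> E" "\<alpha> - ?\<delta> n < u" using \<open>s \<in> E\<close> by (metis less_cSupE empty_iff)
    then show ?thesis unfolding E_def by (auto elim!: countable_subset[rotated])
  qed
  have "K \<inter> {s..<\<alpha>} \<subseteq> (\<Union>n. K \<inter> {s..\<alpha> - ?\<delta> n})"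
  proof
    fix x assume "x \<in> K \<inter> {s..<\<alpha>}"
    moreover from this obtain n where "?\<delta> n < \<alpha> - x" using small[of "\<alpha> - x"] by auto
    ultimately show "x \<in> (\<Union>n. K \<inter> {s..\<alpha> - ?\<delta> n})" by (auto intro!: exI[of _ n])
  qed
  then have "countable (K \<inter> {s..<\<alpha>})"
    by (rule countable_subset) (intro countable_UN countableI_type left)
  moreover have "K \<inter> {s..t} \<subseteq> K \<inter> {s..<\<alpha>} \<union> ({\<alpha>} \<union> (\<Union>n. K \<inter> {\<alpha> + ?\<delta> n..t}))"
  proof
    fix x assume x: "x \<in> K \<inter> {s..t}"
    show "x \<in> K \<inter> {s..<\<alpha>} \<union> ({\<alpha>} \<union> (\<Union>n. K \<inter> {\<alpha> + ?\<delta> n..t}))"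
    proof (cases "\<alpha> < x")
      case True
      then obtain n where "?\<delta> n < x - \<alpha>" using small[of "x - \<alpha>"] by auto
      with x show ?thesis by (auto intro!: exI[of _ n])
    qed (use x in auto)
  qed
  ultimately have "\<not> (\<forall>n. countable (K \<inter> {\<alpha> + ?\<delta> n..t}))"
    using assms by (meson countable_Un countable_UN countableI_type countable_subset
        countable_empty countable_insert)
  then obtain n where n: "uncountable (K \<inter> {\<alpha> + ?\<delta> n..t})" by blast
  define m where "m = \<alpha> + ?\<delta> n"
  have "\<alpha> < m" by (simp add: m_def)
  have "m < t"
  proof (rule ccontr)
    assume "\<not> m < t"
    then have "K \<inter> {m..t} \<subseteq> {t}" by auto
    then have "countable (K \<inter> {m..t})" by (rule countable_subset) simp
    then show False using n by (simp add: m_def)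
  qed
  have "m \<notin> E" using \<open>\<alpha> < m\<close> cSup_upper[OF _ bdd, of m] by (auto simp: \<alpha>_def)
  then have "uncountable (K \<inter> {s..m})"
    using \<open>s \<le> \<alpha>\<close> \<open>\<alpha> < m\<close> \<open>m < t\<close> by (auto simp: E_def)
  with n[folded m_def] \<open>s \<le> \<alpha>\<close> \<open>\<alpha> < m\<close> \<open>m < t\<close> show ?thesis
    by (intro exI[of _ m]) simp
qed

text \<open>
  The value at \<open>n\<close> and \<open>k\<close> is the point of \<open>[a, b]\<close> assigned to the dyadic number
  \<open>k / 2 ^ n\<close>: refining from level \<open>n\<close> to level \<open>Suc n\<close> splits each interval of level \<open>n\<close>
  by \<open>m\<close>.
\<close>

primrec dyadic_point ::
  "(real \<Rightarrow> real \<Rightarrow> real) \<Rightarrow> real \<Rightarrow> real \<Rightarrow> nat \<Rightarrow> nat \<Rightarrow> real" where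
  "dyadic_point m a b 0 k = (if k = 0 then a else b)"
| "dyadic_point m a b (Suc n) k =
    (if even k then dyadic_point m a b n (k div 2)
     else m (dyadic_point m a b n (k div 2)) (dyadic_point m a b n (Suc (k div 2))))"

lemma dyadic_between:
  fixes u v :: real
  assumes "0 \<le> u" "u < v" "v \<le> 1"
  obtains n k :: nat where "k < 2 ^ n" "u < real k / 2 ^ n" "real (Suc k) / 2 ^ n < v"
proof -
  obtain n where "2 / (v - u) < 2 ^ n" using real_arch_pow[of 2 "2 / (v - u)"] by auto
  then have n: "2 < 2 ^ n * (v - u)" using assms by (simp add: field_simps)
  define k where "k = Suc (nat \<lfloor>u * 2 ^ n\<rfloor>)"
  have k: "u * 2 ^ n < real k" "real k \<le> u * 2 ^ n + 1"
    using assms(1) by (simp_all add: k_def) linarith+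
  have "real (Suc k) < v * 2 ^ n" using k(2) n by (simp add: algebra_simps)
  moreover have "v * 2 ^ n \<le> 2 ^ n" using assms(3) by simp
  ultimately have "real k < 2 ^ n" by linarith
  then have "k < 2 ^ n" using of_nat_less_iff[of k "2 ^ n", where 'a = real] by simp
  with k(1) \<open>real (Suc k) < v * 2 ^ n\<close> that show ?thesis
    by (simp add: pos_less_divide_eq pos_divide_less_eq)
qed

text \<open>
  Splitting \<open>[a, b]\<close> again and again into intervals that meet \<open>K\<close> in uncountable sets assigns
  a point to every dyadic number, in increasing order; the staircase is the inverse of this
  assignment, filled up monotonically. It has no jumps because its values are dense, and it is
  constant where \<open>K\<close> is missing because between two points assigned to dyadic numbers there
  are always points of \<open>K\<close>.
\<close>

lemma devil_staircase:
  fixes K :: "real set"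
  assumes "uncountable (K \<inter> {a..b})"
  shows "\<exists>h :: real \<Rightarrow> real. mono h \<and> continuous_on UNIV h \<and> h a = 0 \<and> h b = 1 \<and>
    (\<forall>u v. u < v \<longrightarrow> K \<inter> {u<..<v} = {} \<longrightarrow> h u = h v)"
proof -
  have "\<exists>m. \<forall>s t. uncountable (K \<inter> {s..t}) \<longrightarrow>
      uncountable (K \<inter> {s..m s t}) \<and> uncountable (K \<inter> {m s t..t})"
    using uncountable_Int_split[of K] by metis
  then obtain m where m: "uncountable (K \<inter> {s..t}) \<Longrightarrow> uncountable (K \<inter> {s..m s t})"
      "uncountable (K \<inter> {s..t}) \<Longrightarrow> uncountable (K \<inter> {m s t..t})" for s t
    by auto
  define D where "D = dyadic_point m a b"
  have D0: "D 0 k = (if k = 0 then a else b)" for k by (simp add: D_def)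
  have DS: "D (Suc n) k =
      (if even k then D n (k div 2) else m (D n (k div 2)) (D n (Suc (k div 2))))" for n k
    by (simp add: D_def)
  have unc: "uncountable (K \<inter> {D n k..D n (Suc k)})" if "k < 2 ^ n" for n k
    using that
  proof (induction n arbitrary: k)
    case 0
    then show ?case using assms by (simp add: D0)
  next
    case (Suc n)
    then have IH: "uncountable (K \<inter> {D n (k div 2)..D n (Suc (k div 2))})" by simp
    show ?case
    proof (cases "even k")
      case True
      then have "Suc k div 2 = k div 2" by simp
      with True IH m(1) show ?thesis by (simp add: DS)
    next
      case False
      then have "Suc k div 2 = Suc (k div 2)" by simp
      with False IH m(2) show ?thesis by (simp add: DS)
    qed
  qed
  have step: "D n k < D n (Suc k)" if "k < 2 ^ n" for n k
  proof (rule ccontr)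
    assume "\<not> D n k < D n (Suc k)"
    then have "K \<inter> {D n k..D n (Suc k)} \<subseteq> {D n k}" by auto
    then show False using unc[OF that] countable_subset by (metis countable_insert_eq countable_empty)
  qed
  have less: "D n j < D n k" if "j < k" "k \<le> 2 ^ n" for n j k
    using that
  proof (induction k)
    case (Suc k)
    then show ?case using step[of k n] by (cases "j = k") (auto intro: less_trans)
  qed simp
  have refine: "D (n + l) (k * 2 ^ l) = D n k" for n l k
    by (induction l) (simp_all add: DS mult.left_commute[of k 2])
  \<comment> \<open>Dyadic numbers of different levels are compared at a common level.\<close>
  have cmp: "real j / 2 ^ n \<le> real k / 2 ^ l"
    if "j \<le> 2 ^ n" "k \<le> 2 ^ l" "D n j \<le> D l k" for j n k l
  proof -
    have "\<not> k * 2 ^ n < j * 2 ^ l"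
    proof
      assume "k * 2 ^ n < j * 2 ^ l"
      moreover have "j * 2 ^ l \<le> 2 ^ (n + l)" using that(1) by (simp add: power_add)
      ultimately have "D (n + l) (k * 2 ^ n) < D (n + l) (j * 2 ^ l)" by (rule less)
      then show False using refine[of n l j] refine[of l n k] that(3) by (simp add: add.commute)
    qed
    then have "real (j * 2 ^ l) \<le> real (k * 2 ^ n)" by (simp only: of_nat_le_iff not_less)
    then show ?thesis by (simp add: field_simps)
  qed
  \<comment> \<open>The element \<open>0\<close> provides the value of the staircase to the left of \<open>a\<close>.\<close>
  define P where "P = (\<lambda>t. insert 0 {real k / 2 ^ n | n k. k \<le> 2 ^ n \<and> D n k \<le> t})"
  define h where "h = (\<lambda>t. Sup (P t))"
  have P01: "P t \<subseteq> {0..1}" for t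
  proof -
    have "real k / 2 ^ n \<le> 1" if "k \<le> 2 ^ n" for k n :: nat
      using that of_nat_le_iff[of k "2 ^ n", where 'a = real] by simp
    then show ?thesis by (auto simp: P_def)
  qed
  have "bdd_above (P t)" for t
    using P01[of t] by (meson bdd_above_Icc bdd_above_mono)
  moreover have "P t \<noteq> {}" for t by (simp add: P_def)
  ultimately have h: "mono h" and h01: "0 \<le> h t" "h t \<le> 1" for t
  proof -
    show "mono h"
      unfolding h_def using \<open>\<And>t. bdd_above (P t)\<close> \<open>\<And>t. P t \<noteq> {}\<close>
      by (intro monoI cSup_subset_mono) (auto simp: P_def intro: order_trans)
    show "0 \<le> h t"
      unfolding h_def by (rule cSup_upper) (simp add: P_def, rule \<open>\<And>t. bdd_above (P t)\<close>)
    show "h t \<le> 1"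
      unfolding h_def using P01[of t] by (intro cSup_least) (auto simp: P_def)
  qed
  have hD: "h (D n k) = real k / 2 ^ n" if "k \<le> 2 ^ n" for n k
    unfolding h_def
  proof (rule cSup_eq_maximum)
    show "real k / 2 ^ n \<in> P (D n k)" using that by (auto simp: P_def)
    show "x \<le> real k / 2 ^ n" if "x \<in> P (D n k)" for x
      using that cmp[OF _ \<open>k \<le> 2 ^ n\<close>] by (auto simp: P_def)
  qed
  have const: "h u = h v" if "u < v" "K \<inter> {u<..<v} = {}" for u v
  proof (rule ccontr)
    assume "h u \<noteq> h v"
    with monoD[OF h, of u v] that(1) have "h u < h v" by simp
    then obtain n k :: nat where nk: "k < 2 ^ n" "h u < real k / 2 ^ n" "real (Suc k) / 2 ^ n < h v"
      using dyadic_between[OF h01(1) _ h01(2)] by metis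
    have "h u < h (D n k)" "h (D n (Suc k)) < h v"
      using nk by (simp_all add: hD del: of_nat_Suc)
    then have "u < D n k" "D n (Suc k) < v"
      using mono_strict_invE[OF h] by blast+
    then have "K \<inter> {D n k..D n (Suc k)} \<subseteq> K \<inter> {u<..<v}" by auto
    then show False using unc[OF nk(1)] that(2) by simp
  qed
  have "(h \<longlongrightarrow> h x) (at x)" for x
  proof (rule order_tendstoI)
    fix l assume l: "l < h x"
    show "\<forall>\<^sub>F y in at x. l < h y"
    proof (cases "l < 0")
      case True
      then show ?thesis using h01(1) by (intro always_eventually) (auto intro: less_le_trans)
    next
      case False
      then obtain n k :: nat where nk: "k < 2 ^ n" "l < real k / 2 ^ n" "real (Suc k) / 2 ^ n < h x"
        using dyadic_between[OF _ l h01(2)] by (metis not_less)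
      have "real k / 2 ^ n < h x"
        using nk(3) by (rule le_less_trans[rotated]) (simp add: divide_right_mono)
      then have "h (D n k) < h x" using nk(1) by (simp add: hD)
      then have "D n k < x" by (rule mono_strict_invE[OF h])
      then have "\<forall>\<^sub>F y in at x. D n k < y" using order_tendstoD(1)[OF tendsto_ident_at] by blast
      then show ?thesis
      proof (rule eventually_mono)
        fix y assume "D n k < y"
        then have "h (D n k) \<le> h y" using h by (simp add: monoD)
        then show "l < h y" using nk by (simp add: hD)
      qed
    qed
  next
    fix l assume l: "h x < l"
    show "\<forall>\<^sub>F y in at x. h y < l"
    proof (cases "1 < l")
      case True
      then show ?thesis using h01(2) by (intro always_eventually) (auto intro: le_less_trans)
    next
      case False
      then obtain n k :: nat where nk: "k < 2 ^ n" "h x < real k / 2 ^ n" "real (Suc k) / 2 ^ n < l"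
        using dyadic_between[OF h01(1) l] by (metis not_less)
      have "real k / 2 ^ n < l"
        using nk(3) by (rule le_less_trans[rotated]) (simp add: divide_right_mono)
      have "h x < h (D n k)" using nk by (simp add: hD)
      then have "x < D n k" by (rule mono_strict_invE[OF h])
      then have "\<forall>\<^sub>F y in at x. y < D n k" using order_tendstoD(2)[OF tendsto_ident_at] by blast
      then show ?thesis
      proof (rule eventually_mono)
        fix y assume "y < D n k"
        then have "h y \<le> h (D n k)" using h by (simp add: monoD)
        then show "h y < l" using nk \<open>real k / 2 ^ n < l\<close> by (simp add: hD)
      qed
    qed
  qed
  then have "continuous_on UNIV h" by (simp add: continuous_on_def)
  moreover have "h a = 0" "h b = 1" using hD[of 0 0] hD[of 1 0] by (simp_all add: D0)
  ultimately show ?thesis using h const by blast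
qed

section \<open>Uncountable spaces\<close>

text \<open>
  Adding a devil's staircase on the closure of the image stretches the image by \<open>1\<close> without
  touching its gaps.
\<close>

lemma diam_not_unique_if_uncountable_closure:
  assumes "X \<noteq> {}" "chain_development X f" "bdd_above (f ` X)" "bdd_below (f ` X)"
    and "uncountable (closure (f ` X))"
  shows "\<exists>g. chain_development X g \<and> development_diam X g \<noteq> development_diam X f"
proof -
  let ?A = "f ` X"
  let ?a = "Inf ?A" and ?b = "Sup ?A"
  have "?A \<subseteq> {?a..?b}" using cSup_upper[OF _ assms(3)] cInf_lower[OF _ assms(4)] by auto
  then have "closure ?A \<inter> {?a..?b} = closure ?A"
    using closure_minimal[of ?A "{?a..?b}"] by auto
  with assms(5) obtain h :: "real \<Rightarrow> real"
    where h: "mono h" "continuous_on UNIV h" "h ?a = 0" "h ?b = 1"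
      and const: "\<And>u v. u < v \<Longrightarrow> closure ?A \<inter> {u<..<v} = {} \<Longrightarrow> h u = h v"
    using devil_staircase[of "closure ?A" ?a ?b] by auto
  define \<phi> where "\<phi> = (\<lambda>t. t + h t)"
  have "mono \<phi>" using h(1) by (auto simp: \<phi>_def mono_def intro: add_mono)
  moreover have "continuous_on UNIV \<phi>" unfolding \<phi>_def by (intro continuous_intros h(2))
  moreover have "\<phi> v - \<phi> u = v - u" if "u < v" "?A \<inter> {u<..<v} = {}" for u v
    using const[OF that(1)] that(2) open_Int_closure_eq_empty[of "{u<..<v}" ?A]
    by (simp add: \<phi>_def Int_commute)
  ultimately have "chain_development X (\<phi> \<circ> f)"
    using chain_development_mono_comp_iff[of \<phi> f X] assms(2) by blast
  moreover have "development_diam X (\<phi> \<circ> f) = ereal (?b - ?a + 1)"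
    using development_diam_mono_comp[OF assms(1,3,4) \<open>mono \<phi>\<close> \<open>continuous_on UNIV \<phi>\<close>] h
    by (simp add: \<phi>_def)
  ultimately show ?thesis
    using development_diam_bounded[OF assms(1,3,4)] by (intro exI[of _ "\<phi> \<circ> f"]) simp
qed

text \<open>
  If the closure of the image is countable, then chain distance is positive between distinct
  points of the image, so a chain class is the same as a fibre of \<open>f\<close>; and \<open>f\<close> cannot be
  injective. A fibre with two points \<open>x0\<close> and \<open>x1\<close> contains points at all distances up to
  \<open>dist x0 x1\<close> from \<open>x0\<close>. So that fibre can be spread over an interval of this length, and the
  original development is recovered by collapsing the interval to a point.
\<close>

lemma diam_not_unique_if_countable_closure:
  fixes X :: "'a::metric_space set"
  assumes "compact X" "uncountable X" "chain_development X f"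
    and "bdd_above (f ` X)" "bdd_below (f ` X)"
    and "countable (closure (f ` X))"
  shows "\<exists>g. chain_development X g \<and> development_diam X g \<noteq> development_diam X f"
proof -
  let ?A = "f ` X"
  have "X \<noteq> {}" using assms(2) by auto
  have "countable ?A" using assms(6) closure_subset countable_subset by blast
  then have "\<not> inj_on f X" using assms(2) countable_image_inj_on by blast
  then obtain x0 x1 where x01: "x0 \<in> X" "x1 \<in> X" "f x0 = f x1" "x0 \<noteq> x1"
    by (auto simp: inj_on_def)
  define p R where "p = f x0" and "R = dist x0 x1"
  have "0 < R" using x01 by (simp add: R_def)
  have class01: "chain_dist X x0 x1 = 0"
    using assms(3) x01 by (simp add: chain_development_def chain_dist_self)
  have fibre: "f z = p" if z: "z \<in> X" "chain_dist X x0 z = 0" for z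
  proof (rule ccontr)
    assume "f z \<noteq> p"
    have "chain_dist ?A p (f z) = 0"
      using assms(3) z x01(1) by (simp add: chain_development_def p_def)
    moreover from this have "chain_dist ?A (f z) p = 0"
      using chain_dist_commute[of p ?A "f z"] z x01(1) by (simp add: p_def)
    ultimately have "{min p (f z)..max p (f z)} \<subseteq> closure ?A"
      using dense_if_chain_dist_eq_0[of p ?A "f z"] dense_if_chain_dist_eq_0[of "f z" ?A p]
        z(1) x01(1) \<open>f z \<noteq> p\<close> by (cases "p < f z") (auto simp: p_def)
    then have "countable {min p (f z)..max p (f z)}"
      using assms(6) countable_subset by blast
    then show False
      using uncountable_closed_interval[of "min p (f z)" "max p (f z)"] \<open>f z \<noteq> p\<close> by auto
  qed
  \<comment> \<open>The fibre may extend further than \<open>R\<close> from \<open>x0\<close>; the minimum makes it fill exactly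
    the closed interval \<open>[p, p + R]\<close>.\<close>
  define g where
    "g = (\<lambda>y. if f y < p then f y else if f y = p then p + min (dist x0 y) R else f y + R)"
  \<comment> \<open>\<open>\<phi>\<close> collapses \<open>[p, p + R]\<close> to \<open>p\<close> and shifts what lies beyond it back by \<open>R\<close>.\<close>
  define \<phi> where "\<phi> = (\<lambda>t. min t p + max (t - (p + R)) 0)"
  have "mono \<phi>" by (auto simp: \<phi>_def mono_def min_def max_def)
  have cont: "continuous_on UNIV \<phi>" unfolding \<phi>_def by (intro continuous_intros)
  have "\<phi> \<circ> g = f" using \<open>0 < R\<close> by (auto simp: \<phi>_def g_def fun_eq_iff)
  have spread: "{p..p + R} \<subseteq> g ` X"
  proof
    fix t assume "t \<in> {p..p + R}"
    then have "0 \<le> t - p" "t - p \<le> dist x0 x1" by (auto simp: R_def)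
    from chain_class_intermediate_dist[OF assms(1) x01(1,2) class01 this]
    obtain z where z: "z \<in> X" "chain_dist X x0 z = 0" "dist x0 z = t - p" by blast
    then have "g z = t" using fibre[of z] \<open>t \<in> _\<close> by (simp add: g_def)
    with z(1) show "t \<in> g ` X" by blast
  qed
  have "chain_development X g"
  proof (subst chain_development_mono_comp_iff[symmetric])
    show "\<phi> v - \<phi> u = v - u" if "u < v" "g ` X \<inter> {u<..<v} = {}" for u v
    proof -
      have "v \<le> p \<or> p + R \<le> u"
      proof (rule ccontr)
        assume "\<not> ?thesis"
        then have "max u p < min v (p + R)" using \<open>0 < R\<close> that(1) by auto
        then obtain t where "max u p < t" "t < min v (p + R)" using dense by blast
        then have "t \<in> {p..p + R}" "t \<in> {u<..<v}" by auto
        with spread that(2) show False by blast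
      qed
      then show ?thesis using \<open>0 < R\<close> that(1) by (auto simp: \<phi>_def)
    qed
  qed (use \<open>mono \<phi>\<close> cont \<open>\<phi> \<circ> g = f\<close> assms(3) in simp_all)
  have above: "bdd_above (g ` X)"
  proof -
    obtain M where "\<And>y. y \<in> X \<Longrightarrow> f y \<le> M" using assms(4) by (auto simp: bdd_above_def)
    then have "g y \<le> M + R" if "y \<in> X" for y
      using that \<open>0 < R\<close> by (fastforce simp: g_def min_def)
    then show ?thesis by (auto intro: bdd_aboveI[of _ "M + R"])
  qed
  have below: "bdd_below (g ` X)"
  proof -
    obtain m where "\<And>y. y \<in> X \<Longrightarrow> m \<le> f y" using assms(5) by (auto simp: bdd_below_def)
    moreover have "f y \<le> g y" for y using \<open>0 < R\<close> by (simp add: g_def)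
    ultimately show ?thesis by (auto intro!: bdd_belowI[of _ m] intro: order_trans)
  qed
  have "p + R \<le> Sup (g ` X)" "Inf (g ` X) \<le> p"
    using spread \<open>0 < R\<close> above below by (auto intro!: cSup_upper cInf_lower)
  then have "\<phi> (Sup (g ` X)) - \<phi> (Inf (g ` X)) = Sup (g ` X) - Inf (g ` X) - R"
    using \<open>0 < R\<close> by (simp add: \<phi>_def)
  then have "development_diam X f = ereal (Sup (g ` X) - Inf (g ` X) - R)"
    using development_diam_mono_comp[OF \<open>X \<noteq> {}\<close> above below \<open>mono \<phi>\<close> cont] \<open>\<phi> \<circ> g = f\<close> by simp
  then show ?thesis
    using development_diam_bounded[OF \<open>X \<noteq> {}\<close> above below] \<open>chain_development X g\<close> \<open>0 < R\<close>
    by (intro exI[of _ g]) simp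
qed

lemma diam_not_unique_if_uncountable:
  fixes X :: "'a::metric_space set"
  assumes "compact X" "uncountable X" "chain_development X f"
  shows "\<exists>g h. chain_development X g \<and> chain_development X h \<and>
    development_diam X g \<noteq> development_diam X h"
proof -
  have "X \<noteq> {}" using assms(2) by auto
  obtain g where g: "chain_development X g" "bdd_above (g ` X)" "bdd_below (g ` X)"
    using bounded_chain_development[OF assms(1,3)] by auto
  have "\<exists>h. chain_development X h \<and> development_diam X h \<noteq> development_diam X g"
  proof (cases "countable (closure (g ` X))")
    case True
    then show ?thesis using diam_not_unique_if_countable_closure[OF assms(1,2) g] by simp
  next
    case False
    then show ?thesis using diam_not_unique_if_uncountable_closure[OF \<open>X \<noteq> {}\<close> g] by simp
  qed
  with g(1) show ?thesis by metis
qed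

section \<open>Countable spaces\<close>

text \<open>
  If chain distance separates the points of the image, then it controls the usual distance to
  each of them, say \<open>l\<close>: on either side of \<open>l\<close> there is a gap within distance \<open>\<delta>\<close>, which
  bounds from below the chain distance to all points beyond it. So the compactness that the image inherits from \<open>X\<close> with
  respect to chain distance is compactness in the usual sense.
\<close>

lemma compact_image_chain_development:
  assumes "compact X" "chain_development X f"
    and pos: "\<And>s t. s \<in> f ` X \<Longrightarrow> t \<in> f ` X \<Longrightarrow> chain_dist (f ` X) s t = 0 \<Longrightarrow> s = t"
  shows "compact (f ` X)"
  unfolding compact_def
proof (intro allI impI)
  let ?A = "f ` X"
  have gap: "\<exists>u v. l \<le> u \<and> u < v \<and> v \<le> r \<and> ?A \<inter> {u<..<v} = {}" if less: "l < r" for l r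
  proof (rule ccontr)
    assume "\<not> ?thesis"
    then obtain p q where "p \<in> ?A" "q \<in> ?A" "p < q" "chain_dist ?A p q = 0"
      using chain_dist_eq_0_between_if_dense[OF less, of ?A] by (metis (no_types, lifting))
    then show False using pos by force
  qed
  fix a :: "nat \<Rightarrow> real" assume "\<forall>n. a n \<in> ?A"
  then have a: "a n \<in> ?A" for n by blast
  obtain l \<sigma> where l: "l \<in> ?A" "strict_mono \<sigma>"
      "(\<lambda>n. chain_dist ?A l (a (\<sigma> n))) \<longlonglongrightarrow> 0"
    using chain_development_subseq[where a = a, OF assms(1,2) a] by metis
  have "(a \<circ> \<sigma>) \<longlonglongrightarrow> l"
  proof (rule tendstoI)
    fix \<delta> :: real assume "0 < \<delta>"
    obtain u v where uv: "l \<le> u" "u < v" "v \<le> l + \<delta>" "?A \<inter> {u<..<v} = {}"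
      using gap[of l "l + \<delta>"] \<open>0 < \<delta>\<close> by auto
    obtain u' v' where uv': "l - \<delta> \<le> u'" "u' < v'" "v' \<le> l" "?A \<inter> {u'<..<v'} = {}"
      using gap[of "l - \<delta>" l] \<open>0 < \<delta>\<close> by auto
    have near: "dist t l < \<delta>"
      if t: "t \<in> ?A" "chain_dist ?A l t < min (v - u) (v' - u')" for t
    proof -
      have "\<not> l + \<delta> \<le> t"
        using chain_dist_real_le_iff[of l ?A t "chain_dist ?A l t"] t uv l(1) \<open>0 < \<delta>\<close>
          chain_dist_nonneg[OF l(1) t(1)] by fastforce
      moreover have "\<not> t \<le> l - \<delta>"
        using chain_dist_real_le_iff[of t ?A l "chain_dist ?A l t"] t uv' l(1) \<open>0 < \<delta>\<close>
          chain_dist_nonneg[OF l(1) t(1)] chain_dist_commute[OF l(1) t(1)] by fastforce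
      ultimately show ?thesis by (auto simp: dist_real_def)
    qed
    have "\<forall>\<^sub>F n in sequentially. chain_dist ?A l (a (\<sigma> n)) < min (v - u) (v' - u')"
      using uv(2) uv'(2) by (intro order_tendstoD(2)[OF l(3)]) simp
    then show "\<forall>\<^sub>F n in sequentially. dist ((a \<circ> \<sigma>) n) l < \<delta>"
      by (rule eventually_mono) (use near a in auto)
  qed
  with l show "\<exists>l\<in>?A. \<exists>r. strict_mono r \<and> (a \<circ> r) \<longlonglongrightarrow> l" by blast
qed

fun path_cost :: "('a \<Rightarrow> 'a \<Rightarrow> real) \<Rightarrow> 'a list \<Rightarrow> real" where
  "path_cost c [] = 0"
| "path_cost c [x] = 0"
| "path_cost c (x # y # xs) = c x y + path_cost c (y # xs)"

lemma path_cost_append: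
  "path_cost c (us @ p # ws) = path_cost c (us @ [p]) + path_cost c (p # ws)"
proof (induction us)
  case (Cons u us)
  then show ?case by (cases us) simp_all
qed simp

text \<open>
  Among all orders in which to visit finitely many points, the order along the line is a
  cheapest one. For let \<open>m\<close> be a leftmost point and \<open>q\<close> the next one. Every other point is at
  chain distance at least that of \<open>q\<close> from \<open>m\<close>, so by the ultrametric inequality, taking \<open>m\<close> out of
  an arbitrary path saves at least this much; and it saves exactly this in the sorted path.
\<close>

lemma path_cost_sorted_le:
  assumes "chain_development X f" "set xs \<subseteq> X" "sorted (map f xs)" "mset ys = mset xs"
  shows "path_cost (chain_dist X) xs \<le> path_cost (chain_dist X) ys"
  using assms(2-)
proof (induction xs arbitrary: ys)
  case (Cons m xs)
  let ?c = "chain_dist X"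
  have "m \<in> set ys" using Cons.prems(3) by (metis list.set_intros(1) set_mset_mset)
  then obtain us vs where ys: "ys = us @ m # vs" by (metis split_list)
  then have ms: "mset (us @ vs) = mset xs" using Cons.prems(3) by simp
  then have IH: "path_cost ?c xs \<le> path_cost ?c (us @ vs)"
    using Cons by simp
  show ?case
  proof (cases xs)
    case Nil
    then show ?thesis using ms ys by simp
  next
    case (Cons q xs')
    have XX: "m \<in> X" "set (us @ vs) \<subseteq> X"
      using Cons.prems(1) mset_eq_setD[OF ms] by auto
    have first: "?c m q \<le> ?c m z" if "z \<in> set (us @ vs)" for z
    proof -
      have "z \<in> set xs" using that ms mset_eq_setD by blast
      then have "f m \<le> f q" "f q \<le> f z" "q \<in> X" "z \<in> X"
        using Cons Cons.prems by auto
      then show ?thesis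
        using assms(1) XX chain_dist_real_mono[of "f m" "f ` X" "f q" "f z"]
        by (simp add: chain_development_def)
    qed
    have "?c m q + path_cost ?c (us @ vs) \<le> path_cost ?c ys"
    proof (cases us rule: rev_cases)
      case Nil
      then show ?thesis using Cons ms ys first by (cases vs) auto
    next
      case (snoc us' u)
      have um: "?c u m = ?c m u" using XX snoc by (intro chain_dist_commute) auto
      show ?thesis
      proof (cases vs)
        case Nil
        then show ?thesis
          using snoc ys first[of u] um path_cost_append[of ?c us' u "[m]"] by simp
      next
        case v: (Cons v vs')
        have "?c u v \<le> max (?c u m) (?c m v)"
          using XX snoc v by (intro chain_dist_ultrametric) auto
        then have "?c m q + ?c u v \<le> ?c u m + ?c m v"
          using first[of u] first[of v] um snoc v by auto
        then show ?thesis
          using snoc v ys path_cost_append[of ?c us' u "m # v # vs'"]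
            path_cost_append[of ?c us' u "v # vs'"] by simp
      qed
    qed
    then show ?thesis using IH Cons by simp
  qed
qed simp

lemma path_cost_map_chain_development:
  assumes "chain_development X f" "set xs \<subseteq> X"
  shows "path_cost (chain_dist (f ` X)) (map f xs) = path_cost (chain_dist X) xs"
  using assms(2)
proof (induction xs rule: induct_list012)
  case (3 x y zs)
  then show ?case using assms(1) by (simp add: chain_development_def)
qed simp_all

lemma path_cost_sorted_le_diff:
  fixes A :: "real set"
  assumes "set (x # xs) \<subseteq> A" "sorted (x # xs)"
  shows "path_cost (chain_dist A) (x # xs) \<le> last (x # xs) - x"
  using assms
proof (induction xs arbitrary: x)
  case (Cons y xs)
  then have "chain_dist A x y \<le> y - x"
    using chain_dist_le_dist[of x A y] by (simp add: dist_real_def)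
  moreover have "path_cost (chain_dist A) (y # xs) \<le> last (y # xs) - y"
    using Cons.prems by (intro Cons.IH) auto
  ultimately show ?case by simp
qed simp

text \<open>
  Leave the interval \<open>(l i, r i)\<close> that covers \<open>a\<close> behind by moving to the last point \<open>a0\<close> of
  \<open>A\<close> up to \<open>r i\<close> and then to the first point \<open>a'\<close> of \<open>A\<close> from \<open>r i\<close> on. The points \<open>a0\<close> and
  \<open>a'\<close> are the same or bound a gap, so the cost of this step is all of \<open>a' - a0\<close>, and the loss is
  at most \<open>a0 - a\<close>, which is less than the length of the interval. The part of \<open>A\<close> from
  \<open>a'\<close> on is covered by the other intervals.
\<close>

lemma path_cost_cover:
  fixes A :: "real set"
  assumes "compact A" "finite I" "\<And>i. i \<in> I \<Longrightarrow> l i \<le> r i"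
    and "a \<in> A" "b \<in> A" "a \<le> b" "A \<inter> {a..b} \<subseteq> (\<Union>i\<in>I. {l i<..<r i})"
  shows "\<exists>xs. set xs \<subseteq> A \<and> sorted (a # xs) \<and>
    b - a - (\<Sum>i\<in>I. r i - l i) \<le> path_cost (chain_dist A) (a # xs)"
  using assms(2-)
proof (induction I arbitrary: a rule: finite_psubset_induct)
  case (psubset I)
  obtain i where i: "i \<in> I" "l i < a" "a < r i" using psubset.prems by fastforce
  have sum: "(\<Sum>i\<in>I. r i - l i) = r i - l i + (\<Sum>i\<in>I - {i}. r i - l i)"
    using psubset.hyps i(1) by (simp add: sum.remove)
  show ?case
  proof (cases "r i \<le> b")
    case False
    have "0 \<le> (\<Sum>i\<in>I - {i}. r i - l i)" using psubset.prems by (intro sum_nonneg) auto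
    then show ?thesis using False i sum by (intro exI[of _ "[]"]) auto
  next
    case True
    have compact: "compact (A \<inter> {s..t})" for s t by (simp add: assms(1) compact_Int_closed)
    have "b \<in> A \<inter> {r i..b}" using psubset.prems True by simp
    then obtain a' where a': "a' \<in> A \<inter> {r i..b}" "\<And>t. t \<in> A \<inter> {r i..b} \<Longrightarrow> a' \<le> t"
      using compact_attains_inf[OF compact] by (metis empty_iff)
    have "a \<in> A \<inter> {a..r i}" using psubset.prems i by simp
    then obtain a0 where a0: "a0 \<in> A \<inter> {a..r i}" "\<And>t. t \<in> A \<inter> {a..r i} \<Longrightarrow> t \<le> a0"
      using compact_attains_sup[OF compact] by (metis empty_iff)
    have "A \<inter> {a'..b} \<subseteq> (\<Union>i\<in>I - {i}. {l i<..<r i})"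
    proof
      fix t assume t: "t \<in> A \<inter> {a'..b}"
      then have "t \<in> A \<inter> {a..b}" using a'(1) i by auto
      with psubset.prems(5) obtain j where "j \<in> I" "t \<in> {l j<..<r j}" by blast
      moreover from this have "j \<noteq> i" using t a'(1) by auto
      ultimately show "t \<in> (\<Union>i\<in>I - {i}. {l i<..<r i})" by blast
    qed
    then obtain xs where xs: "set xs \<subseteq> A" "sorted (a' # xs)"
        "b - a' - (\<Sum>i\<in>I - {i}. r i - l i) \<le> path_cost (chain_dist A) (a' # xs)"
      using psubset.IH[of "I - {i}" a'] psubset.prems i(1) a'(1) by auto
    have "A \<inter> {a0<..<a'} = {}"
    proof (rule ccontr)
      assume "\<not> ?thesis"
      then obtain t where t: "t \<in> A" "a0 < t" "t < a'" by auto
      show False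
      proof (cases "t \<le> r i")
        case True
        then show False using a0(2)[of t] a0(1) t by auto
      next
        case False
        then show False using a'(2)[of t] a'(1) t by auto
      qed
    qed
    then have "a' - a0 \<le> chain_dist A a0 a'"
      using a0(1) a'(1) by (intro chain_dist_gap) auto
    moreover have "0 \<le> chain_dist A a a0" using a0(1) psubset.prems by (intro chain_dist_nonneg) auto
    ultimately have "b - a - (\<Sum>i\<in>I. r i - l i) \<le> path_cost (chain_dist A) (a # a0 # a' # xs)"
      using xs(3) sum i a0(1) by simp
    moreover have "sorted (a # a0 # a' # xs)" using xs(2) a0(1) a'(1) by fastforce
    moreover have "set (a0 # a' # xs) \<subseteq> A" using xs(1) a0(1) a'(1) by simp
    ultimately show ?thesis by blast
  qed
qed

text \<open>
  A countable compact set is covered by finitely many intervals of total length at most \<open>\<eta>\<close>.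
\<close>

lemma path_cost_countable:
  fixes A :: "real set"
  assumes "compact A" "countable A" "a \<in> A" "b \<in> A" "a \<le> b" "0 < \<eta>"
  shows "\<exists>xs. set xs \<subseteq> A \<and> sorted (a # xs) \<and> b - a - \<eta> \<le> path_cost (chain_dist A) (a # xs)"
proof -
  define w where "w = (\<lambda>x. \<eta> / 4 * (1 / 2) ^ to_nat_on A x)"
  have w: "0 < w x" for x using assms(6) by (simp add: w_def)
  have "A \<subseteq> (\<Union>x\<in>A. {x - w x<..<x + w x})" using w by force
  then obtain C where C: "C \<subseteq> A" "finite C" "A \<subseteq> (\<Union>x\<in>C. {x - w x<..<x + w x})"
    using compactE_image[OF assms(1), of A "\<lambda>x. {x - w x<..<x + w x}"] by auto
  have "inj_on (to_nat_on A) C"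
    using inj_on_to_nat_on[OF assms(2)] C(1) inj_on_subset by blast
  then have "(\<Sum>x\<in>C. (1 / 2 :: real) ^ to_nat_on A x) = (\<Sum>n\<in>to_nat_on A ` C. (1 / 2) ^ n)"
    by (simp add: sum.reindex)
  also have "\<dots> \<le> (\<Sum>n. (1 / 2) ^ n)"
    using C(2) by (intro sum_le_suminf) (auto intro: summable_geometric)
  also have "\<dots> = 2" by (subst suminf_geometric) simp_all
  finally have "\<eta> / 2 * (\<Sum>x\<in>C. (1 / 2 :: real) ^ to_nat_on A x) \<le> \<eta>" using assms(6) by simp
  then have "(\<Sum>x\<in>C. (x + w x) - (x - w x)) \<le> \<eta>"
    by (simp add: w_def sum_distrib_left)
  moreover obtain xs where "set xs \<subseteq> A" "sorted (a # xs)"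
      "b - a - (\<Sum>x\<in>C. (x + w x) - (x - w x)) \<le> path_cost (chain_dist A) (a # xs)"
    using path_cost_cover[OF assms(1) C(2), of "\<lambda>x. x - w x" "\<lambda>x. x + w x" a b] w assms(3-5) C(3)
    by (force simp: less_imp_le)
  ultimately show ?thesis by (intro exI[of _ xs]) simp
qed

text \<open>
  Up to an arbitrarily small loss, the diameter of the image of \<open>f\<close> is the cost of a path sorted
  by \<open>f\<close>. Sorting it by \<open>g\<close> instead does not lower the cost, which is then at most the
  diameter of the image of \<open>g\<close>.
\<close>

lemma development_diam_le_of_countable:
  fixes X :: "'a::metric_space set"
  assumes "compact X" "X \<noteq> {}" "countable X" "chain_development X f" "chain_development X g"
  shows "development_diam X f \<le> development_diam X g"
proof -
  have comp: "compact (h ` X)" if h: "chain_development X h" for h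
  proof (rule compact_image_chain_development[OF assms(1) h])
    fix s t assume "s \<in> h ` X" "t \<in> h ` X" "chain_dist (h ` X) s t = 0"
    then obtain x y where "x \<in> X" "y \<in> X" "s = h x" "t = h y" "chain_dist X x y = 0"
      using h by (auto simp: chain_development_def)
    then show "s = t" using chain_dist_eq_0_imp_eq_of_countable[OF assms(1,3)] by blast
  qed
  have bdd: "bdd_above (h ` X)" "bdd_below (h ` X)" if "chain_development X h" for h
    using compact_imp_bounded[OF comp[OF that]]
    by (simp_all add: bounded_imp_bdd_above bounded_imp_bdd_below)
  let ?A = "f ` X"
  have ends: "Inf ?A \<in> ?A" "Sup ?A \<in> ?A"
    using assms(2) bdd[OF assms(4)] compact_imp_closed[OF comp[OF assms(4)]]
    by (simp_all add: closed_contains_Inf closed_contains_Sup)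
  have "Inf ?A \<le> Sup ?A" using ends bdd[OF assms(4)] by (simp add: cInf_lower)
  have "Sup ?A - Inf ?A \<le> (Sup (g ` X) - Inf (g ` X)) + \<eta>" if pos: "0 < \<eta>" for \<eta>
  proof -
    obtain xs where xs: "set xs \<subseteq> ?A" "sorted (Inf ?A # xs)"
        "Sup ?A - Inf ?A - \<eta> \<le> path_cost (chain_dist ?A) (Inf ?A # xs)"
      using path_cost_countable[OF comp[OF assms(4)] countable_image[OF assms(3)] ends
          \<open>Inf ?A \<le> Sup ?A\<close> pos] by blast
    define ys where "ys = map (inv_into X f) (Inf ?A # xs)"
    have img: "set (Inf ?A # xs) \<subseteq> ?A" using xs(1) ends by simp
    then have "map (f \<circ> inv_into X f) (Inf ?A # xs) = Inf ?A # xs"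
      by (intro map_idI) (auto simp: f_inv_into_f)
    then have ys: "Inf ?A # xs = map f ys" by (simp add: ys_def)
    have ysX: "set ys \<subseteq> X" unfolding ys_def using img by (auto intro: inv_into_into)
    define zs where "zs = sort_key g ys"
    have zs: "set zs \<subseteq> X" "sorted (map g zs)" "mset zs = mset ys" "zs \<noteq> []"
      using ys ysX by (auto simp: zs_def)
    obtain u us where us: "map g zs = u # us" using zs(4) by (cases zs) auto
    have sub: "set (u # us) \<subseteq> g ` X" using zs(1) by (auto simp flip: us)
    have "path_cost (chain_dist ?A) (Inf ?A # xs) = path_cost (chain_dist X) ys"
      using path_cost_map_chain_development[OF assms(4) ysX] ys by simp
    also have "\<dots> \<le> path_cost (chain_dist X) zs"
      using path_cost_sorted_le[OF assms(4) ysX _ zs(3)] ys xs(2) by simp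
    also have "\<dots> = path_cost (chain_dist (g ` X)) (u # us)"
      using path_cost_map_chain_development[OF assms(5) zs(1)] us by simp
    also have "\<dots> \<le> last (u # us) - u"
      using path_cost_sorted_le_diff[OF sub] zs(2) us by simp
    also have "\<dots> \<le> Sup (g ` X) - Inf (g ` X)"
      using bdd[OF assms(5)] sub by (intro diff_mono cSup_upper cInf_lower) (auto dest: last_in_set)
    finally show ?thesis using xs(3) by simp
  qed
  then have "Sup ?A - Inf ?A \<le> Sup (g ` X) - Inf (g ` X)" by (rule field_le_epsilon)
  then show ?thesis
    using development_diam_bounded[OF assms(2) bdd[OF assms(4)]]
      development_diam_bounded[OF assms(2) bdd[OF assms(5)]] by simp
qed

theorem theorem1:
  fixes X :: "'a::metric_space set"
  assumes "compact X"
    and "X \<noteq> {}"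
    and "\<exists>f. chain_development X f"
  shows "(\<forall>f g. chain_development X f \<and> chain_development X g \<longrightarrow>
            development_diam X f = development_diam X g) \<longleftrightarrow> countable X"
proof
  assume "\<forall>f g. chain_development X f \<and> chain_development X g \<longrightarrow>
    development_diam X f = development_diam X g"
  then show "countable X"
    using diam_not_unique_if_uncountable[OF assms(1)] assms(3) by metis
next
  assume "countable X"
  then show "\<forall>f g. chain_development X f \<and> chain_development X g \<longrightarrow>
    development_diam X f = development_diam X g"
    using development_diam_le_of_countable[OF assms(1,2)] by (simp add: antisym)
qed

end
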